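(* Let $(A,B,p,r,c)$ be an LPP situation with producer set $N$. If the one-block partition $\{N\}$ belongs to $M^{\min}$, then $\{N\}$ is the only element of $M^{\min}$, and the related partition function form game $(N,\mathcal{P}(N),\{V(\bullet|P)\}_{P\in\mathcal{P}(N)})$ is a characteristic function form game, i.e. for every nonempty $S\subseteq N$ and all $P,P'\in\mathcal{P}(N)$ with $S\in P$ and $S\in P'$ one has $V(S|P)=V(S|P')$.
   Context: LPP situation (linear production situation with a common-pool resource). $N=\{1,\dots,n\}$ is a set of producers, $G=\{1,\dots,g\}$ a set of goods, $Q=\{1,\dots,q\}$ a set of resources; in addition there is one external common-pool resource, of which a total amount $r\ge 0$ is available at unit cost $c\ge 0$. Producer $i$ owns $b^i\in\mathbb{R}_+^q$; $b^S=\sum_{i\in S}b^i$; $B$ is the $q\times n$ matrix with columns $b^i$, and for every $t\in Q$ there is a producer $i$ with $b^i_t>0$. $A$ is a nonnegative $(q+1)\times g$ matrix ($a_{tj}$ is the amount of resource $t$ needed per unit of good $j$; row $q+1$ refers to the common-pool resource), with $a_{(q+1)j}>0$ for all $j\in G$ and, for every $j\in G$, some $t\in Q$ with $a_{tj}>0$. $p\in\mathbb{R}_{++}^g$ is the price vector and $p_j>a_{(q+1)j}c$ for all $j\in G$. For a coalition $S\subseteq N$ and $z\ge 0$, $$\mathrm{value}(S;z)=\max\Big\{\sum_{j=1}^g p_jx_j-cz \;:\; Ax\le \begin{pmatrix} b^S\\ z\end{pmatrix},\ x\in\mathbb{R}^g_+\Big\}.$$ The optimal demand of $S$ is $d_S=\min\{z\ge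 0:\ \mathrm{value}(S;z)=\max_{z'\ge 0}\mathrm{value}(S;z')\}$. It is assumed that for every nonempty $S$ there is $z$ with $\mathrm{value}(S;z)>0$ (so $d_S>0$). $\mathcal{P}(N)$ is the set of partitions of $N$ into nonempty coalitions. $P'$ is a refinement of $P$, written $P'\subseteq P$, if each $S'\in P'$ is contained in some $S\in P$. For $P\in\mathcal{P}(N)$ put $d(P)=\sum_{S\in P}d_S$. Then $M^{\min}=\{P\in\mathcal{P}(N): d(P)>r$ and $P$ is minimal for $\subseteq\}$, where minimal means that no refinement $P'\neq P$ of $P$ satisfies $d(P')>r$. Partition function form game. When partition $P$ forms, the manager of the common-pool resource allocates (by some fixed procedure) an amount $z_S(P)\ge 0$ to each $S\in P$, with $z_S(P)\le d_S$, $\sum_{S\in P}z_S(P)\le r$, and with $z_S(P)=d_S$ for all $S\in P$ whenever $d(P)\le r$; also $z_N(\{N\})=\min\{d_N,r\}$. Then $V(S|P)=\mathrm{value}(S;z_S(P))$ for $S\in P$. *)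

theory Defs
  imports "HOL-Analysis.Analysis" "HOL-Library.Disjoint_Sets"
begin

text \<open>
  The producers, goods and owned resources are the elements of the finite types \<open>'n\<close>, \<open>'g\<close>, \<open>'q\<close>;
  the grand coalition is \<open>UNIV :: 'n set\<close>. The \<open>q + 1\<close> rows of the technology matrix \<open>A\<close> are indexed by
  \<open>'q option\<close>: row \<open>Some t\<close> is the owned resource \<open>t\<close>, row \<open>None\<close> is the common-pool resource.
  The columns of \<open>B\<close> are the resource bundles of the producers. Orders on vectors are componentwise.
\<close>

definition coalition_resources :: "real ^ 'n::finite ^ 'q::finite \<Rightarrow> 'n set \<Rightarrow> real ^ 'q" where
  "coalition_resources B S = (\<Sum>i\<in>S. column i B)"

definition feasible_production ::
  "real ^ 'g::finite ^ ('q::finite option) \<Rightarrow> real ^ 'n::finite ^ 'q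
     \<Rightarrow> 'n set \<Rightarrow> real \<Rightarrow> (real ^ 'g) set" where
  "feasible_production A B S z =
     {x. 0 \<le> x \<and>
         A *v x \<le> (\<chi> k. case k of Some t \<Rightarrow> coalition_resources B S $ t | None \<Rightarrow> z)}"

text \<open>
  In an LPP situation the maxima and the minimum in the next three definitions exist for all
  \<open>S\<close> and \<open>z \<ge> 0\<close>; see \<open>coalition_value_max\<close>, \<open>best_value_max\<close> and \<open>optimal_demand_min\<close> below.
\<close>

definition coalition_value ::
  "real ^ 'g::finite ^ ('q::finite option) \<Rightarrow> real ^ 'n::finite ^ 'q
     \<Rightarrow> real ^ 'g \<Rightarrow> real \<Rightarrow> 'n set \<Rightarrow> real \<Rightarrow> real" where
  "coalition_value A B p c S z =
     (GREATEST v. \<exists>x\<in>feasible_production A B S z. v = p \<bullet> x - c * z)"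

definition best_value ::
  "real ^ 'g::finite ^ ('q::finite option) \<Rightarrow> real ^ 'n::finite ^ 'q
     \<Rightarrow> real ^ 'g \<Rightarrow> real \<Rightarrow> 'n set \<Rightarrow> real" where
  "best_value A B p c S = (GREATEST v. \<exists>z\<ge>0. v = coalition_value A B p c S z)"

definition optimal_demand ::
  "real ^ 'g::finite ^ ('q::finite option) \<Rightarrow> real ^ 'n::finite ^ 'q
     \<Rightarrow> real ^ 'g \<Rightarrow> real \<Rightarrow> 'n set \<Rightarrow> real" where
  "optimal_demand A B p c S =
     (LEAST z. 0 \<le> z \<and> coalition_value A B p c S z = best_value A B p c S)"

locale lpp_situation =
  fixes A :: "real ^ 'g::finite ^ ('q::finite option)"
    and B :: "real ^ 'n::finite ^ 'q::finite"
    and p :: "real ^ 'g::finite"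
    and r c :: real
  assumes r_nonneg: "0 \<le> r"
    and c_nonneg: "0 \<le> c"
    and B_nonneg: "0 \<le> B $ t $ i"
    and B_owned: "\<exists>i. 0 < B $ t $ i"
    and A_nonneg: "0 \<le> A $ k $ j"
    and A_common: "0 < A $ None $ j"
    and A_owned: "\<exists>t. 0 < A $ Some t $ j"
    and p_pos: "0 < p $ j"
    and p_profitable: "A $ None $ j * c < p $ j"
    and value_pos: "S \<noteq> {} \<Longrightarrow> \<exists>z\<ge>0. 0 < coalition_value A B p c S z"

definition total_demand ::
  "real ^ 'g::finite ^ ('q::finite option) \<Rightarrow> real ^ 'n::finite ^ 'q
     \<Rightarrow> real ^ 'g \<Rightarrow> real \<Rightarrow> 'n set set \<Rightarrow> real" where
  "total_demand A B p c P = (\<Sum>S\<in>P. optimal_demand A B p c S)"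

definition M_min ::
  "real ^ 'g::finite ^ ('q::finite option) \<Rightarrow> real ^ 'n::finite ^ 'q
     \<Rightarrow> real ^ 'g \<Rightarrow> real \<Rightarrow> real \<Rightarrow> 'n set set set" where
  "M_min A B p r c =
     {P. partition_on UNIV P \<and> r < total_demand A B p c P \<and>
         \<not> (\<exists>P'. refines UNIV P' P \<and> P' \<noteq> P \<and> r < total_demand A B p c P')}"

text \<open>
  \<open>\<zeta> P S\<close> is the amount of the common-pool resource that the manager gives to the block \<open>S\<close> of the
  partition \<open>P\<close>; its values for \<open>S \<notin> P\<close> are irrelevant.
\<close>

locale lpp_allocation = lpp_situation A B p r c
  for A :: "real ^ 'g::finite ^ ('q::finite option)" and B :: "real ^ 'n::finite ^ 'q"
    and p :: "real ^ 'g" and r c :: real +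
  fixes \<zeta> :: "'n set set \<Rightarrow> 'n set \<Rightarrow> real"
  assumes alloc_nonneg: "\<lbrakk>partition_on UNIV P; S \<in> P\<rbrakk> \<Longrightarrow> 0 \<le> \<zeta> P S"
    and alloc_le_demand: "\<lbrakk>partition_on UNIV P; S \<in> P\<rbrakk> \<Longrightarrow> \<zeta> P S \<le> optimal_demand A B p c S"
    and alloc_total: "partition_on UNIV P \<Longrightarrow> (\<Sum>S\<in>P. \<zeta> P S) \<le> r"
    and alloc_full: "\<lbrakk>partition_on UNIV P; total_demand A B p c P \<le> r; S \<in> P\<rbrakk>
                       \<Longrightarrow> \<zeta> P S = optimal_demand A B p c S"
    and alloc_grand: "\<zeta> {UNIV} UNIV = min (optimal_demand A B p c UNIV) r"

definition pff_value ::
  "real ^ 'g::finite ^ ('q::finite option) \<Rightarrow> real ^ 'n::finite ^ 'q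
     \<Rightarrow> real ^ 'g \<Rightarrow> real \<Rightarrow> ('n set set \<Rightarrow> 'n set \<Rightarrow> real) \<Rightarrow> 'n set \<Rightarrow> 'n set set \<Rightarrow> real" where
  "pff_value A B p c \<zeta> S P = coalition_value A B p c S (\<zeta> P S)"

text \<open>A partition function form game is given by \<open>V S P\<close> for partitions \<open>P\<close> and \<open>S \<in> P\<close>.\<close>

definition characteristic_function_form :: "('n set \<Rightarrow> 'n set set \<Rightarrow> real) \<Rightarrow> bool" where
  "characteristic_function_form V \<longleftrightarrow>
     (\<forall>S P P'. S \<noteq> {} \<and> partition_on UNIV P \<and> partition_on UNIV P' \<and> S \<in> P \<and> S \<in> P'
        \<longrightarrow> V S P = V S P')"

context lpp_situation
begin

definition owned_feasible where
  "owned_feasible S = {x. 0 \<le> x \<and> (\<forall>t. (A *v x) $ Some t \<le> coalition_resources B S $ t)}"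

lemma feas_iff: "x \<in> feasible_production A B S z \<longleftrightarrow> x \<in> owned_feasible S \<and> (A *v x) $ None \<le> z"
  unfolding feasible_production_def owned_feasible_def less_eq_vec_def mem_Collect_eq
    split_option_all[where 'a = 'q]
  by auto

lemma owned_feasible_nonneg: "x \<in> owned_feasible S \<Longrightarrow> 0 \<le> x $ j"
  by (simp add: owned_feasible_def less_eq_vec_def)

lemma res_nonneg: "0 \<le> coalition_resources B S $ t"
  by (simp add: coalition_resources_def column_def B_nonneg sum_nonneg)

lemma zero_owned_feasible: "0 \<in> owned_feasible S"
  by (simp add: owned_feasible_def res_nonneg)

lemma pool_nonneg: "x \<in> owned_feasible S \<Longrightarrow> 0 \<le> (A *v x) $ None"
  by (simp add: matrix_vector_mult_def sum_nonneg A_nonneg owned_feasible_nonneg)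

lemma continuous_on_row: "continuous_on X (\<lambda>x. (A *v x) $ k)"
  unfolding matrix_vector_mult_def by (simp, intro continuous_intros)

lemma compact_owned_feasible: "compact (owned_feasible S)"
proof -
  have cl: "closed (owned_feasible S)"
    unfolding owned_feasible_def less_eq_vec_def
    by (intro closed_Collect_conj closed_Collect_all closed_Collect_le continuous_on_row continuous_intros)
  have "\<exists>u. \<forall>x\<in>owned_feasible S. norm (x $ j) \<le> u" for j
  proof -
    obtain t where t: "0 < A $ Some t $ j" using A_owned by blast
    have "norm (x $ j) \<le> coalition_resources B S $ t / A $ Some t $ j" if x: "x \<in> owned_feasible S" for x
    proof -
      have "A $ Some t $ j * x $ j \<le> (\<Sum>i\<in>UNIV. A $ Some t $ i * x $ i)"
        by (rule member_le_sum) (auto simp: A_nonneg owned_feasible_nonneg[OF x])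
      also have "\<dots> \<le> coalition_resources B S $ t"
        using x by (auto simp: owned_feasible_def matrix_vector_mult_def)
      finally show ?thesis using t owned_feasible_nonneg[OF x, of j] by (simp add: field_simps)
    qed
    then show ?thesis by blast
  qed
  then obtain u where u: "\<And>j x. x \<in> owned_feasible S \<Longrightarrow> norm (x $ j) \<le> u j" by metis
  have "norm x \<le> (\<Sum>j\<in>UNIV. u j)" if "x \<in> owned_feasible S" for x
  proof -
    have "norm x \<le> (\<Sum>j\<in>UNIV. norm (x $ j))" using norm_le_l1_cart[of x] by simp
    also have "\<dots> \<le> (\<Sum>j\<in>UNIV. u j)" using u[OF that] by (rule sum_mono)
    finally show ?thesis .
  qed
  then have "bounded (owned_feasible S)" by (auto simp: bounded_iff)
  then show ?thesis using cl compact_eq_bounded_closed by blast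
qed

lemma coalition_value_max:
  assumes "0 \<le> z"
  shows "\<exists>x\<in>feasible_production A B S z. coalition_value A B p c S z = p \<bullet> x - c * z"
    and "x \<in> feasible_production A B S z \<Longrightarrow> p \<bullet> x - c * z \<le> coalition_value A B p c S z"
proof -
  have eq: "feasible_production A B S z = owned_feasible S \<inter> {x. (A *v x) $ None \<le> z}"
    by (auto simp: feas_iff)
  have "compact (feasible_production A B S z)"
    unfolding eq by (intro compact_Int_closed compact_owned_feasible closed_Collect_le continuous_on_row continuous_intros)
  moreover have "feasible_production A B S z \<noteq> {}"
    using assms zero_owned_feasible[of S] feas_iff[of 0 S z] by (auto simp: matrix_vector_mult_def)
  ultimately obtain y where y: "y \<in> feasible_production A B S z"
    "\<forall>x\<in>feasible_production A B S z. p \<bullet> x \<le> p \<bullet> y"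
    using continuous_attains_sup[of _ "\<lambda>x. p \<bullet> x"] continuous_on_inner[OF continuous_on_const continuous_on_id]
    by blast
  have "coalition_value A B p c S z = p \<bullet> y - c * z"
    unfolding coalition_value_def
  proof (rule Greatest_equality)
    show "\<exists>x\<in>feasible_production A B S z. p \<bullet> y - c * z = p \<bullet> x - c * z"
      using y(1) by blast
    fix v assume "\<exists>x\<in>feasible_production A B S z. v = p \<bullet> x - c * z"
    then obtain x where "x \<in> feasible_production A B S z" "v = p \<bullet> x - c * z" by blast
    then show "v \<le> p \<bullet> y - c * z" using bspec[OF y(2)] by fastforce
  qed
  note val = this
  show "\<exists>x\<in>feasible_production A B S z. coalition_value A B p c S z = p \<bullet> x - c * z"
    using val y(1) by (rule bexI)
  show "p \<bullet> x - c * z \<le> coalition_value A B p c S z" if "x \<in> feasible_production A B S z"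
    unfolding val using bspec[OF y(2) that] by linarith
qed

definition "net_profit x = p \<bullet> x - c * (A *v x) $ None"

lemma net_profit_le:
  assumes "x \<in> feasible_production A B S z" shows "p \<bullet> x - c * z \<le> net_profit x"
  using assms c_nonneg by (simp add: feas_iff net_profit_def mult_left_mono)

lemma net_profit_max:
  "\<exists>x\<in>owned_feasible S. net_profit x = best_value A B p c S" (is ?A)
  "x \<in> owned_feasible S \<Longrightarrow> net_profit x \<le> best_value A B p c S" (is "_ \<Longrightarrow> ?B")
  "\<exists>z\<ge>0. best_value A B p c S = coalition_value A B p c S z" (is ?C)
  "0 \<le> z \<Longrightarrow> coalition_value A B p c S z \<le> best_value A B p c S" (is "_ \<Longrightarrow> ?D")
proof -
  have "continuous_on (owned_feasible S) net_profit"
    unfolding net_profit_def by (intro continuous_intros continuous_on_row)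
  then obtain y where y: "y \<in> owned_feasible S" "\<forall>x\<in>owned_feasible S. net_profit x \<le> net_profit y"
    using continuous_attains_sup[OF compact_owned_feasible, of S net_profit] zero_owned_feasible by blast
  have le: "coalition_value A B p c S z \<le> net_profit y" if z: "0 \<le> z" for z
    using coalition_value_max(1)[OF z, of S] net_profit_le[of _ S z] y feas_iff by fastforce
  let ?z = "(A *v y) $ None"
  have z0: "0 \<le> ?z" using pool_nonneg y by blast
  have "y \<in> feasible_production A B S ?z" using y feas_iff by blast
  from coalition_value_max(2)[OF z0 this] le[OF z0]
  have zy: "coalition_value A B p c S ?z = net_profit y" by (simp add: net_profit_def)
  have b: "best_value A B p c S = net_profit y"
    unfolding best_value_def
  proof (rule Greatest_equality)
    show "\<exists>z\<ge>0. net_profit y = coalition_value A B p c S z" using zy z0 by metis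
  qed (use le in auto)
  show ?A using b y by auto
  show ?C using b z0 zy by (intro exI[of _ ?z]) simp
  show ?B if "x \<in> owned_feasible S" using b y that by auto
  show ?D if "0 \<le> z" using b le that by auto
qed

lemmas best_value_max = net_profit_max(3,4)

lemma optimal_demand_min:
  shows "0 \<le> optimal_demand A B p c S"
    and "coalition_value A B p c S (optimal_demand A B p c S) = best_value A B p c S"
    and "\<lbrakk>0 \<le> z; coalition_value A B p c S z = best_value A B p c S\<rbrakk>
           \<Longrightarrow> optimal_demand A B p c S \<le> z"
proof -
  let ?O = "owned_feasible S \<inter> {x. best_value A B p c S \<le> net_profit x}"
  let ?Q = "\<lambda>z. 0 \<le> z \<and> coalition_value A B p c S z = best_value A B p c S"
  have "continuous_on UNIV net_profit"
    unfolding net_profit_def by (intro continuous_intros continuous_on_row)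
  then have "compact ?O"
    by (intro compact_Int_closed compact_owned_feasible closed_Collect_le continuous_on_const)
  moreover have "?O \<noteq> {}" using net_profit_max(1)[of S] by auto
  ultimately obtain y where y: "y \<in> ?O" "\<forall>x\<in>?O. (A *v y) $ None \<le> (A *v x) $ None"
    using continuous_attains_inf[OF _ _ continuous_on_row, of ?O None] by blast
  let ?z = "(A *v y) $ None"
  have z0: "0 \<le> ?z" using pool_nonneg y by blast
  have "y \<in> feasible_production A B S ?z" using y feas_iff by blast
  from coalition_value_max(2)[OF z0 this] net_profit_max(4)[OF z0, of S] y(1)
  have q: "?Q ?z" using z0 by (simp add: net_profit_def)
  have m: "?z \<le> z" if zQ: "?Q z" for z
  proof -
    obtain x where x: "x \<in> feasible_production A B S z" "best_value A B p c S = p \<bullet> x - c * z"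
      using coalition_value_max(1)[of z S] zQ by force
    then have "x \<in> ?O" using net_profit_le[OF x(1)] feas_iff by auto
    from bspec[OF y(2) this] show ?thesis using x(1) feas_iff[of x S z] by linarith
  qed
  have "optimal_demand A B p c S = ?z"
    unfolding optimal_demand_def by (rule Least_equality) (use q m in auto)
  then show "0 \<le> optimal_demand A B p c S"
    and "coalition_value A B p c S (optimal_demand A B p c S) = best_value A B p c S"
    and "\<lbrakk>0 \<le> z; coalition_value A B p c S z = best_value A B p c S\<rbrakk>
           \<Longrightarrow> optimal_demand A B p c S \<le> z"
    using q m by auto
qed

end

end

theory Submission
  imports Defs
begin

text \<open>Minimality of \<open>{UNIV}\<close> forces every other partition to have total demand at
  most \<open>r\<close>. So none of them lies in \<open>M_min\<close>, and in each the manager gives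
  every block its full optimal demand, which depends on the block alone.\<close>

lemma refines_singleton:
  assumes "partition_on A P" "A \<noteq> {}"
  shows "refines A P {A}"
  using assms by (auto simp: refines_def partition_on_def disjoint_def)

lemma partition_on_whole_block:
  assumes "partition_on A P" "A \<in> P"
  shows "P = {A}"
proof -
  have "S = A" if "S \<in> P" for S
  proof (rule ccontr)
    assume "S \<noteq> A"
    then have "S \<inter> A = {}"
      using assms that unfolding partition_on_def by (auto dest: disjointD)
    moreover have "S \<noteq> {}" "S \<subseteq> A"
      using assms(1) that by (auto simp: partition_on_def)
    ultimately show False by blast
  qed
  with assms(2) show ?thesis by blast
qed

theorem proposition7:
  fixes A :: "real ^ 'g::finite ^ ('q::finite option)" and B :: "real ^ 'n::finite ^ 'q"
    and p :: "real ^ 'g" and r c :: real and \<zeta> :: "'n set set \<Rightarrow> 'n set \<Rightarrow> real"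
  assumes "lpp_allocation A B p r c \<zeta>"
    and "{UNIV} \<in> M_min A B p r c"
  shows "M_min A B p r c = {{UNIV}} \<and> characteristic_function_form (pff_value A B p c \<zeta>)"
proof -
  interpret lpp_allocation A B p r c \<zeta> by fact
  \<comment> \<open>Every partition refines \<open>{UNIV}\<close>, so minimality bounds the demand of all the others.\<close>
  have slack: "total_demand A B p c P \<le> r" if "partition_on UNIV P" "P \<noteq> {UNIV}" for P
    using assms(2) refines_singleton[OF that(1)] that(2) by (force simp: M_min_def)
  have "M_min A B p r c = {{UNIV}}"
    using assms(2) slack by (force simp: M_min_def)
  moreover have "\<zeta> P S = \<zeta> P' S"
    if "partition_on UNIV P" "partition_on UNIV P'" "S \<in> P" "S \<in> P'" for P P' S
  proof (cases "S = UNIV")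
    case True
    \<comment> \<open>\<open>slack\<close> says nothing about \<open>{UNIV}\<close>, but no other
      partition has the block \<open>UNIV\<close>, so \<open>P = P'\<close>.\<close>
    then show ?thesis using that partition_on_whole_block by metis
  next
    case False
    then have "P \<noteq> {UNIV}" "P' \<noteq> {UNIV}" using that by auto
    \<comment> \<open>Both sides equal \<open>optimal_demand A B p c S\<close>.\<close>
    then show ?thesis using alloc_full slack that by metis
  qed
  ultimately show ?thesis
    unfolding characteristic_function_form_def pff_value_def by metis
qed

end
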